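(* Let $T$ be a tree with $n$ vertices. Then the edge set of $T$ can be decomposed into at most $\left\lfloor \frac{n+1}{2} \right\rfloor$ pairwise edge-disjoint paths; that is, there is a collection of at most $\left\lfloor \frac{n+1}{2} \right\rfloor$ paths in $T$ such that every edge of $T$ belongs to exactly one path of the collection.
   Context: All graphs are finite, simple and undirected. A path is a sequence of distinct vertices in which consecutive vertices are adjacent; its edges are the edges joining consecutive vertices. A graph with $n$ vertices is said to satisfy Gallai's conjecture if it can be decomposed into at most $\left\lfloor \frac{n+1}{2}\right\rfloor$ edge-disjoint paths that together contain all its edges. *)

theory Defs
  imports "Graph_Theory.Graph_Theory"
begin

text \<open>
  Finite simple undirected graphs are the library's \<^locale>\<open>graph\<close>s: finite symmetric digraphs
  without loops and parallel arcs. An undirected edge joining \<open>u\<close> and \<open>v\<close> is represented there by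
  the two arcs \<open>(u, v)\<close> and \<open>(v, u)\<close>, so edges have to be counted as unordered pairs.
\<close>

definition uedges :: "('a, 'b) pre_digraph \<Rightarrow> 'a set set" where
  "uedges G = {{u, v} | u v. u \<rightarrow>\<^bsub>G\<^esub> v}"

text \<open>
  The library's \<^const>\<open>tree\<close> is not usable for these graphs: its cycles include the closed walks
  \<open>u, v, u\<close> that traverse one undirected edge back and forth. The cycles of a simple undirected
  graph are exactly the library's cycles of length at least 3.
\<close>

definition ucycle :: "('a, 'b) pre_digraph \<Rightarrow> 'b awalk \<Rightarrow> bool" where
  "ucycle G c \<longleftrightarrow> pre_digraph.cycle G c \<and> 3 \<le> length c"

definition utree :: "('a, 'b) pre_digraph \<Rightarrow> bool" where
  "utree G \<longleftrightarrow> graph G \<and> connected G \<and> (\<nexists>c. ucycle G c)"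

definition path_edges :: "'a vwalk \<Rightarrow> 'a set set" where
  "path_edges p = {{u, v} | u v. (u, v) \<in> set (vwalk_arcs p)}"

text \<open>
  Paths are the library's \<^const>\<open>vpath\<close>s, nonempty sequences of distinct vertices with consecutive
  vertices adjacent. One-vertex paths are allowed. A set of paths loses nothing against a multiset,
  as a path with an edge cannot occur twice.
\<close>

definition path_decomposition :: "('a, 'b) pre_digraph \<Rightarrow> 'a vwalk set \<Rightarrow> bool" where
  "path_decomposition G P \<longleftrightarrow>
     finite P \<and> (\<forall>p\<in>P. vpath p G) \<and> (\<forall>e\<in>uedges G. \<exists>!p. p \<in> P \<and> e \<in> path_edges p)"

end

theory Submission
  imports Defs
begin

text \<open>
  A decomposition with as few paths as possible works. In a graph without cycles, two edge-disjoint
  paths that start at the same vertex \<open>v\<close> meet nowhere else, since following the first one to its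
  first return to the second, and then the second one back to \<open>v\<close>, would close a cycle
  (\<open>edge_disjoint_vpaths_meet_only_at_hd\<close>). Hence two paths of a decomposition that share an end
  can be joined there into one path, which gives a decomposition with fewer paths
  (\<open>path_decomposition_join\<close>). So in a smallest decomposition into paths with at least one edge, no
  two paths share an end. Each of these paths has two distinct ends, so there are at most half as
  many paths as vertices.
\<close>

section \<open>Edges of paths\<close>

lemma path_edges_rev [simp]: "path_edges (rev p) = path_edges p"
  by (auto simp: path_edges_def set_vwalk_arcs_rev insert_commute)

lemma path_edges_join: "joinable p q \<Longrightarrow> path_edges (p \<oplus> q) = path_edges p \<union> path_edges q"
  by (auto simp: path_edges_def vwalk_join_arcs)

lemma path_edges_pair [simp]: "path_edges [u, v] = {{u, v}}"
  by (auto simp: path_edges_def)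

lemma path_edges_subset_uedges: "vwalk p G \<Longrightarrow> path_edges p \<subseteq> uedges G"
  by (auto simp: path_edges_def uedges_def)

lemma (in sym_digraph) vwalk_rev: "vwalk p G \<Longrightarrow> vwalk (rev p) G"
  by (auto simp: vwalk_def set_vwalk_arcs_rev intro: arcs_ends_symmetric[OF sym_arcs])

lemma (in sym_digraph) vpath_rev: "vpath p G \<Longrightarrow> vpath (rev p) G"
  by (simp add: vpath_def vwalk_rev)

lemma path_decomposition_edge_disjoint:
  assumes "path_decomposition G P" "p \<in> P" "q \<in> P" "p \<noteq> q"
  shows "path_edges p \<inter> path_edges q = {}"
proof -
  have "path_edges p \<subseteq> uedges G"
    using assms by (auto simp: path_decomposition_def vpath_def dest: path_edges_subset_uedges)
  then show ?thesis
    using assms unfolding path_decomposition_def by blast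
qed

section \<open>Joining paths in graphs without cycles\<close>

lemma (in wf_digraph) awalk_of_vwalk:
  "vwalk p G \<Longrightarrow> \<exists>es. awalk (hd p) es (last p) \<and> awalk_verts (hd p) es = p"
proof (induct p rule: vwalk_induct)
  case (Base u)
  then show ?case by (intro exI[of _ "[]"]) (simp add: awalk_Nil_iff)
next
  case (Cons u v ps)
  then obtain es where es: "awalk v es (last (v # ps))" "awalk_verts v es = v # ps"
    by auto
  obtain e where "e \<in> arcs G" "tail G e = u" "head G e = v"
    using Cons(1) by (auto simp: arcs_ends_conv)
  with es show ?case
    by (intro exI[of _ "e # es"]) (simp add: awalk_Cons_iff)
qed

text \<open>
  A closed walk given by vertices repeats its first vertex at the end, so one of length 3 or more
  has at least 4 entries.
\<close>

lemma (in wf_digraph) ucycle_of_closed_vwalk: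
  assumes "vwalk c G" "hd c = last c" "distinct (tl c)" "4 \<le> length c"
  shows "\<exists>es. ucycle G es"
proof -
  obtain es where es: "awalk (hd c) es (last c)" "awalk_verts (hd c) es = c"
    using awalk_of_vwalk[OF assms(1)] by blast
  then have "length c = Suc (length es)"
    by (metis length_awalk_verts)
  then have "3 \<le> length es" "es \<noteq> []"
    using assms(4) by auto
  with es assms show ?thesis
    unfolding ucycle_def cycle_def by metis
qed

text \<open>
  A second common vertex closes a cycle. Disjointness of the edges ensures that this cycle is not
  just one edge traversed back and forth.
\<close>

lemma (in sym_digraph) edge_disjoint_vpaths_meet_only_at_hd:
  assumes acyclic: "\<nexists>c. ucycle G c"
    and p: "vpath p G" and q: "vpath q G" and hd: "hd p = hd q"
    and disj: "path_edges p \<inter> path_edges q = {}"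
  shows "set p \<inter> set q = {hd p}"
proof (rule ccontr)
  assume neq: "set p \<inter> set q \<noteq> {hd p}"
  obtain v p' where p': "p = v # p'"
    using p by (cases p) auto
  obtain q' where q': "q = v # q'"
    using q hd p' by (cases q) auto
  have "\<exists>x\<in>set p'. x \<in> set q'"
    using neq p q unfolding p' q' vpath_def by auto
  \<comment> \<open>\<open>x\<close> is the first vertex at which \<open>p\<close> returns to \<open>q\<close>, so \<open>a\<close> avoids \<open>q\<close>.\<close>
  then obtain a x b where a: "p' = a @ x # b" "x \<in> set q'" "\<forall>y\<in>set a. y \<notin> set q'"
    using split_list_first_prop[of p' "\<lambda>x. x \<in> set q'"] by blast
  obtain c d where c: "q' = c @ x # d"
    using a(2) by (auto dest: split_list)
  let ?p = "v # a @ [x]" and ?q = "v # c @ [x]"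
  have p_split: "p = ?p \<oplus> (x # b)" and q_split: "q = ?q \<oplus> (x # d)"
    by (simp_all add: p' q' a c vwalk_join_def)
  have walks: "vwalk ?p G" "vwalk ?q G"
    using p q unfolding p_split q_split vpath_def by (auto intro: vwalkI_vwalk_join_l)
  let ?c = "?p \<oplus> rev ?q"
  have "vwalk ?c G"
    using walks(1) vwalk_rev[OF walks(2)] by (rule vwalk_joinI_vwalk') simp
  moreover have "hd ?c = last ?c"
    by (simp add: vwalk_join_def)
  moreover have "distinct (tl ?c)"
    using p q a by (auto simp: vpath_def p' q' c vwalk_join_def)
  moreover have "4 \<le> length ?c"
  proof -
    \<comment> \<open>Otherwise both paths would run from \<open>v\<close> to \<open>x\<close> along the edge joining them.\<close>
    have "a \<noteq> [] \<or> c \<noteq> []"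
    proof (rule ccontr)
      assume "\<not> ?thesis"
      then have "{v, x} \<in> path_edges p" "{v, x} \<in> path_edges q"
        by (auto simp: p' q' a c path_edges_def)
      with disj show False by blast
    qed
    then show ?thesis
      by (cases a; cases c) (auto simp: vwalk_join_def)
  qed
  ultimately show False
    using ucycle_of_closed_vwalk acyclic by blast
qed

lemma (in sym_digraph) vpath_join_of_edge_disjoint:
  assumes "\<nexists>c. ucycle G c"
    and p: "vpath p G" and q: "vpath q G" and hd: "hd p = hd q"
    and "path_edges p \<inter> path_edges q = {}"
  shows "vpath (rev p \<oplus> q) G"
proof -
  have meet: "set p \<inter> set q = {hd p}"
    using assms by (rule edge_disjoint_vpaths_meet_only_at_hd)
  have ne: "p \<noteq> []" "q \<noteq> []"
    using p q by auto
  then have "vwalk (rev p \<oplus> q) G"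
    using p q hd by (auto simp: vpath_def last_rev intro: vwalk_joinI_vwalk' vwalk_rev)
  moreover have "set p \<inter> set (tl q) = {}"
    using meet q hd ne by (cases q) (auto simp: vpath_def)
  then have "distinct (rev p \<oplus> q)"
    using p q by (simp add: vwalk_join_def vpath_def distinct_tl)
  ultimately show ?thesis ..
qed

text \<open>
  A path has no direction as a set of edges, so an end shared by two paths may be taken to be the
  first vertex of both.
\<close>

lemma (in sym_digraph) vpath_directed_from_end:
  assumes "vpath p G" "x \<in> {hd p, last p}"
  obtains p' where "vpath p' G" "hd p' = x" "path_edges p' = path_edges p" "length p' = length p"
proof (cases "x = hd p")
  case True
  show ?thesis
    using assms True by (intro that[of p]) simp_all
next
  case False
  then show ?thesis
    using assms by (intro that[of "rev p"]) (simp_all add: vpath_rev hd_rev)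
qed

text \<open>
  Replacing two paths with a common end by their join keeps every edge covered exactly once. The
  bound on the lengths excludes one-vertex paths, whose two ends coincide, and is carried along
  because the final count needs two ends per path.
\<close>

lemma (in sym_digraph) path_decomposition_join:
  assumes acyclic: "\<nexists>c. ucycle G c"
    and P: "path_decomposition G P" "\<forall>p\<in>P. 2 \<le> length p"
    and pq: "p \<in> P" "q \<in> P" "p \<noteq> q"
    and x: "x \<in> {hd p, last p}" "x \<in> {hd q, last q}"
  shows "\<exists>P'. path_decomposition G P' \<and> (\<forall>p\<in>P'. 2 \<le> length p) \<and> card P' < card P"
proof -
  have fin: "finite P" and vp: "\<forall>p\<in>P. vpath p G"
    and ex1: "\<forall>e\<in>uedges G. \<exists>!p. p \<in> P \<and> e \<in> path_edges p"
    using P by (auto simp: path_decomposition_def)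
  obtain p' where p': "vpath p' G" "hd p' = x" "path_edges p' = path_edges p" "length p' = length p"
    using vpath_directed_from_end x(1) vp pq by metis
  obtain q' where q': "vpath q' G" "hd q' = x" "path_edges q' = path_edges q" "length q' = length q"
    using vpath_directed_from_end x(2) vp pq by metis
  have disj: "path_edges p \<inter> path_edges q = {}"
    using path_decomposition_edge_disjoint P(1) pq by blast
  define r where "r = rev p' \<oplus> q'"
  have r: "vpath r G"
    unfolding r_def using vpath_join_of_edge_disjoint[OF acyclic p'(1) q'(1)] p' q' disj by simp
  have "p' \<noteq> []" "q' \<noteq> []"
    using p' q' by auto
  then have r_edges: "path_edges r = path_edges p \<union> path_edges q"
    unfolding r_def using p' q' by (simp add: path_edges_join last_rev)
  have r_length: "2 \<le> length r"
    using p'(4) P(2) pq by (simp add: r_def vwalk_join_def trans_le_add1)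
  define P' where "P' = insert r (P - {p, q})"
  have "\<exists>!s. s \<in> P' \<and> e \<in> path_edges s" if e: "e \<in> uedges G" for e
  proof -
    obtain s where s: "s \<in> P" "e \<in> path_edges s" and uniq: "\<And>t. t \<in> P \<Longrightarrow> e \<in> path_edges t \<Longrightarrow> t = s"
      using ex1 e by blast
    show ?thesis
    proof (cases "s \<in> {p, q}")
      case True
      then have "e \<in> path_edges r"
        using s r_edges by blast
      with True uniq show ?thesis
        unfolding P'_def by (intro ex1I[of _ r]) auto
    next
      case False
      then have "e \<notin> path_edges r"
        using uniq pq r_edges by blast
      show ?thesis
      proof (rule ex1I[of _ s])
        show "s \<in> P' \<and> e \<in> path_edges s"
          using False s by (simp add: P'_def)
        show "t = s" if "t \<in> P' \<and> e \<in> path_edges t" for t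
          using that \<open>e \<notin> path_edges r\<close> uniq[of t] by (auto simp: P'_def)
      qed
    qed
  qed
  then have "path_decomposition G P'"
    using fin vp r by (auto simp: path_decomposition_def P'_def)
  moreover have "\<forall>p\<in>P'. 2 \<le> length p"
    using P(2) r_length by (simp add: P'_def)
  moreover have "card P' < card P"
  proof -
    have "card {p, q} \<le> card P"
      using fin pq by (intro card_mono) auto
    then show ?thesis
      using fin pq card_insert_le_m1[of "card P - 1" "P - {p, q}" r]
      by (simp add: P'_def card_Diff_subset)
  qed
  ultimately show ?thesis by blast
qed

section \<open>Smallest decompositions\<close>

text \<open>The single edges form a decomposition, so a smallest one exists.\<close>

lemma (in graph) ex_nontrivial_path_decomposition:
  "\<exists>P. path_decomposition G P \<and> (\<forall>p\<in>P. 2 \<le> length p)"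
proof -
  have "\<forall>e\<in>uedges G. \<exists>p. vpath p G \<and> length p = 2 \<and> path_edges p = {e}"
  proof
    fix e assume "e \<in> uedges G"
    then obtain u v where e: "e = {u, v}" and uv: "u \<rightarrow> v"
      by (auto simp: uedges_def)
    then have "vpath [u, v] G"
      using adj_in_verts[OF uv] adj_not_same by (auto simp: vpath_def vwalk_def)
    with e show "\<exists>p. vpath p G \<and> length p = 2 \<and> path_edges p = {e}"
      by (intro exI[of _ "[u, v]"]) simp
  qed
  then obtain r where r: "\<forall>e\<in>uedges G. vpath (r e) G \<and> length (r e) = 2 \<and> path_edges (r e) = {e}"
    by metis
  have "finite (r ` uedges G)"
    using r by (intro finite_subset[OF _ vpaths_finite]) auto
  with r have "path_decomposition G (r ` uedges G)"
    by (auto simp: path_decomposition_def)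
  with r show ?thesis
    by (intro exI[of _ "r ` uedges G"]) simp
qed

lemma (in graph) acyclic_path_decomposition:
  assumes acyclic: "\<nexists>c. ucycle G c"
  shows "\<exists>P. path_decomposition G P \<and> 2 * card P \<le> card (verts G)"
proof -
  obtain P where P: "path_decomposition G P" "\<forall>p\<in>P. 2 \<le> length p"
    and least: "\<And>P'. path_decomposition G P' \<and> (\<forall>p\<in>P'. 2 \<le> length p) \<Longrightarrow> card P \<le> card P'"
    using ex_has_least_nat[of "\<lambda>P. path_decomposition G P \<and> (\<forall>p\<in>P. 2 \<le> length p)" _ card]
      ex_nontrivial_path_decomposition by metis
  have fin: "finite P" and vp: "\<And>p. p \<in> P \<Longrightarrow> vpath p G"
    using P(1) by (auto simp: path_decomposition_def)
  define ends where "ends p = {hd p, last p}" for p :: "'a list"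
  have "ends p \<inter> ends q = {}" if "p \<in> P" "q \<in> P" "p \<noteq> q" for p q
    using path_decomposition_join[OF acyclic P that] least unfolding ends_def
    by (meson disjoint_iff leD)
  then have "card (\<Union>p\<in>P. ends p) = (\<Sum>p\<in>P. card (ends p))"
    using fin by (intro card_UN_disjoint) (auto simp: ends_def)
  also have "\<dots> = (\<Sum>p\<in>P. 2)"
  proof (rule sum.cong)
    fix p assume p: "p \<in> P"
    obtain u v ps where "p = u # v # ps"
      using P(2) p by (cases p rule: vwalk_arcs.cases) auto
    then have "hd p \<noteq> last p"
      using vp[OF p] by (auto simp: vpath_def)
    then show "card (ends p) = 2"
      by (simp add: ends_def)
  qed simp
  finally have "2 * card P = card (\<Union>p\<in>P. ends p)"
    by simp
  also have "\<dots> \<le> card (verts G)"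
  proof (rule card_mono)
    show "(\<Union>p\<in>P. ends p) \<subseteq> verts G"
    proof
      fix x assume "x \<in> (\<Union>p\<in>P. ends p)"
      then obtain p where p: "p \<in> P" "x = hd p \<or> x = last p"
        by (auto simp: ends_def)
      have "vwalk p G"
        using vp[OF p(1)] by (simp add: vpath_def)
      then show "x \<in> verts G"
        using p(2) by (auto simp: vwalk_def)
    qed
  qed simp
  finally show ?thesis
    using P(1) by blast
qed

theorem theorem2p1:
  fixes T :: "('a, 'b) pre_digraph" and n :: nat
  assumes "utree T"
    and "card (verts T) = n"
  shows "\<exists>P. path_decomposition T P \<and> card P \<le> (n + 1) div 2"
proof -
  interpret graph T
    using assms(1) by (simp add: utree_def)
  obtain P where "path_decomposition T P" "2 * card P \<le> card (verts T)"
    using acyclic_path_decomposition assms(1) by (auto simp: utree_def)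
  with assms(2) show ?thesis
    by (intro exI[of _ P]) simp
qed

end
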